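(* Let $K$ be a field of characteristic $0$ and let $F = x + H : K^n \to K^n$ be an invertible polynomial map of degree $d$. If $\ker \mathcal{J} H \cap K^n$ has dimension $n - r$ as a $K$-vector space, then the inverse polynomial map of $F$ has degree at most $d^r$.
   Context: A polynomial map $F : K^n \to K^n$ is a tuple $F = (F_1,\ldots,F_n)$ of polynomials $F_i \in K[x_1,\ldots,x_n]$; its degree is $\max_i \deg F_i$ (total degree). $x = (x_1,\ldots,x_n)$ denotes the identity map, and $H = (H_1,\ldots,H_n)$ with $H_i \in K[x_1,\ldots,x_n]$. $F$ is invertible if it has an inverse that is a polynomial map (a two-sided inverse for composition of polynomial maps). $\mathcal{J} H = \left(\frac{\partial H_i}{\partial x_j}\right)_{i,j}$ is the Jacobian matrix, and $\ker \mathcal{J} H \cap K^n = \{v \in K^n : \mathcal{J} H \cdot v = 0 \text{ in } K[x_1,\ldots,x_n]^n\}$ is the space of constant vectors in its kernel. *)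

theory Defs
  imports "HOL-Analysis.Cartesian_Space" "HOL-Library.Poly_Mapping"
begin

text \<open>
  A polynomial over \<open>'k\<close> in variables indexed by the finite type \<open>'n\<close> is a finitely supported map
  from exponent vectors to coefficients, with the (convolution) ring structure of
  \<^theory>\<open>HOL-Library.Poly_Mapping\<close>. The dimension of the ambient affine space is \<open>CARD('n)\<close>.
\<close>

type_synonym ('k, 'n) mpoly = "('n \<Rightarrow>\<^sub>0 nat) \<Rightarrow>\<^sub>0 'k"

type_synonym ('k, 'n) poly_map = "('k, 'n) mpoly ^ 'n"

definition mpoly_const :: "'k \<Rightarrow> ('k::zero, 'n) mpoly"
  where "mpoly_const c = Poly_Mapping.single 0 c"

definition mpoly_var :: "'n \<Rightarrow> ('k::zero_neq_one, 'n) mpoly"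
  where "mpoly_var i = Poly_Mapping.single (Poly_Mapping.single i 1) 1"

text \<open>The zero polynomial gets total degree \<open>0\<close>; it is never a component of an invertible map.\<close>

definition total_degree :: "('k::zero, 'n::finite) mpoly \<Rightarrow> nat"
  where "total_degree p =
    Max (insert 0 ((\<lambda>m. \<Sum>i\<in>UNIV. Poly_Mapping.lookup m i) ` Poly_Mapping.keys p))"

text \<open>
  The subtraction of exponents is truncated, but only in terms not containing \<open>x\<^sub>i\<close>, whose
  coefficient is multiplied by \<open>0\<close>.
\<close>

definition mpoly_pderiv :: "'n \<Rightarrow> ('k::comm_semiring_1, 'n) mpoly \<Rightarrow> ('k, 'n) mpoly"
  where "mpoly_pderiv i p =
    (\<Sum>m\<in>Poly_Mapping.keys p.
      Poly_Mapping.single (m - Poly_Mapping.single i 1)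
        (of_nat (Poly_Mapping.lookup m i) * Poly_Mapping.lookup p m))"

definition mpoly_subst :: "('k::comm_semiring_1, 'n::finite) mpoly \<Rightarrow> ('k, 'n) poly_map \<Rightarrow> ('k, 'n) mpoly"
  where "mpoly_subst p G =
    (\<Sum>m\<in>Poly_Mapping.keys p.
      mpoly_const (Poly_Mapping.lookup p m) * (\<Prod>i\<in>UNIV. (G $ i) ^ Poly_Mapping.lookup m i))"

definition id_map :: "('k::zero_neq_one, 'n::finite) poly_map"
  where "id_map = (\<chi> i. mpoly_var i)"

definition map_compose :: "('k::comm_semiring_1, 'n::finite) poly_map \<Rightarrow> ('k, 'n) poly_map \<Rightarrow> ('k, 'n) poly_map"
  where "map_compose F G = (\<chi> i. mpoly_subst (F $ i) G)"

definition is_inverse_map :: "('k::comm_semiring_1, 'n::finite) poly_map \<Rightarrow> ('k, 'n) poly_map \<Rightarrow> bool"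
  where "is_inverse_map F G \<longleftrightarrow> map_compose F G = id_map \<and> map_compose G F = id_map"

definition map_degree :: "('k::zero, 'n::finite) poly_map \<Rightarrow> nat"
  where "map_degree F = Max (range (\<lambda>i. total_degree (F $ i)))"

definition jacobian_mat :: "('k::comm_semiring_1, 'n::finite) poly_map \<Rightarrow> ('k, 'n) mpoly ^ 'n ^ 'n"
  where "jacobian_mat H = (\<chi> i j. mpoly_pderiv j (H $ i))"

definition const_vec :: "'k ^ 'n::finite \<Rightarrow> ('k::zero, 'n) mpoly ^ 'n"
  where "const_vec v = (\<chi> i. mpoly_const (v $ i))"

definition const_kernel :: "('k::comm_semiring_1, 'n::finite) poly_map \<Rightarrow> ('k ^ 'n) set"
  where "const_kernel H = {v. jacobian_mat H *v const_vec v = 0}"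

end

theory Submission
  imports Defs
begin

text \<open>
  Choose linear coordinates in which the last \<open>n - r\<close> coordinate directions span the constant
  kernel. There \<open>F\<close> becomes \<open>P = L + q\<close> with \<open>L\<close> linear and \<open>q\<close> depending on the first \<open>r\<close>
  variables only, so all components have weighted degree at most \<open>d\<close> when these variables get
  weight \<open>1\<close> and the others weight \<open>d\<close>.

  Let \<open>g\<close> be a component of the inverse and \<open>h\<close> the linear form with \<open>g(P) = h\<close>. The products
  \<open>P\<^sup>a h\<^sup>b\<close> with \<open>|a| + b \<le> D\<close> have weighted degree at most \<open>d D\<close>, hence span a space of dimension
  at most \<open>d\<^sup>r\<close> times the number \<open>C D\<close> of monomials of degree at most \<open>D\<close>. Substituting the
  inverse turns them into \<open>y\<^sup>a g\<^sup>b\<close>, which span a space of dimension at least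
  \<open>deg g \<sqdot> C (D - deg g)\<close>, as one sees from leading monomials. As \<open>C\<close> grows polynomially, letting
  \<open>D\<close> tend to infinity gives \<open>deg g \<le> d\<^sup>r\<close>.
\<close>

section \<open>Substitution and partial derivatives\<close>

lemma sum_single_lookup: "(\<Sum>m\<in>Poly_Mapping.keys p. Poly_Mapping.single m (Poly_Mapping.lookup p m)) = p"
  by (rule poly_mapping_eqI)
    (auto simp: lookup_sum lookup_single when_def in_keys_iff)

lemma mpoly_const_0 [simp]: "mpoly_const 0 = 0"
  and mpoly_const_1 [simp]: "mpoly_const 1 = 1"
  and mpoly_const_add: "mpoly_const (a + b) = mpoly_const a + mpoly_const b"
  and mpoly_const_mult: "mpoly_const (a * b) = mpoly_const a * mpoly_const b"
  for a b :: "'k::comm_semiring_1"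
  by (simp_all add: mpoly_const_def single_add mult_single)

lemma mpoly_const_sum: "mpoly_const (\<Sum>x\<in>A. f x) = (\<Sum>x\<in>A. mpoly_const (f x))"
  for f :: "'a \<Rightarrow> 'k::comm_semiring_1"
  by (induction A rule: infinite_finite_induct) (auto simp: mpoly_const_add)

lemma lookup_mpoly_const_mult:
  "Poly_Mapping.lookup (mpoly_const a * p) m = a * Poly_Mapping.lookup p m"
  for p :: "('k::comm_semiring_1, 'n) mpoly"
  by (simp add: mpoly_const_def mult_map_scale_conv_mult [symmetric] Poly_Mapping.map.rep_eq when_def)

lemma mpoly_var_power:
  "(mpoly_var i :: ('k::comm_semiring_1, 'n) mpoly) ^ k = Poly_Mapping.single (Poly_Mapping.single i k) 1"
  by (induction k) (simp_all add: mpoly_var_def mult_single single_add [symmetric])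

lemma single_one_eq_prod_var:
  "Poly_Mapping.single m 1 = (\<Prod>i\<in>UNIV. (mpoly_var i :: ('k::comm_semiring_1, 'n::finite) mpoly) ^ Poly_Mapping.lookup m i)"
proof -
  have prod: "(\<Prod>i\<in>A. Poly_Mapping.single (f i) (1::'k)) = Poly_Mapping.single (\<Sum>i\<in>A. f i) 1"
    if "finite A" for A and f :: "'n \<Rightarrow> 'n \<Rightarrow>\<^sub>0 nat"
    using that by induction (simp_all add: mult_single)
  have "(\<Sum>i\<in>UNIV. Poly_Mapping.single i (Poly_Mapping.lookup m i)) = m"
    by (rule poly_mapping_eqI) (simp add: lookup_sum lookup_single when_def)
  then show ?thesis
    by (simp add: mpoly_var_power prod)
qed

lemma single_eq_const_mult_prod_var:
  "Poly_Mapping.single m c =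
    mpoly_const c * (\<Prod>i\<in>UNIV. (mpoly_var i :: ('k::comm_semiring_1, 'n::finite) mpoly) ^ Poly_Mapping.lookup m i)"
  by (simp add: single_one_eq_prod_var [symmetric] mpoly_const_def mult_single)

text \<open>Constants and variables generate the polynomial ring, so an identity compatible with
  sums and products has to be checked on these generators only.\<close>

lemma mpoly_induct [case_names const var add mult]:
  fixes p :: "('k::comm_semiring_1, 'n::finite) mpoly"
  assumes const: "\<And>c. P (mpoly_const c)"
    and var: "\<And>i. P (mpoly_var i)"
    and add: "\<And>p q. P p \<Longrightarrow> P q \<Longrightarrow> P (p + q)"
    and mult: "\<And>p q. P p \<Longrightarrow> P q \<Longrightarrow> P (p * q)"
  shows "P p"
proof -
  have one: "P 1" using const [of 1] by simp
  have pow: "P (p ^ k)" if "P p" for p k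
    by (induction k) (auto intro: one mult that)
  have prod: "P (\<Prod>i\<in>A. f i)" if "\<And>i. P (f i)" for A :: "'n set" and f
    by (induction A rule: infinite_finite_induct) (auto intro: one mult that)
  have sum: "P (\<Sum>m\<in>A. f m)" if "\<And>m. P (f m)" for A :: "('n \<Rightarrow>\<^sub>0 nat) set" and f
    by (induction A rule: infinite_finite_induct) (use const [of 0] in \<open>auto intro: add that\<close>)
  have "P (Poly_Mapping.single m c)" for m c
    unfolding single_eq_const_mult_prod_var by (intro mult const prod pow var)
  then have "P (\<Sum>m\<in>Poly_Mapping.keys p. Poly_Mapping.single m (Poly_Mapping.lookup p m))"
    by (intro sum)
  then show ?thesis by (simp add: sum_single_lookup)
qed

section \<open>Substitution as a ring homomorphism\<close>

lemma mpoly_subst_superset: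
  assumes "finite S" "Poly_Mapping.keys p \<subseteq> S"
  shows "mpoly_subst p G =
    (\<Sum>m\<in>S. mpoly_const (Poly_Mapping.lookup p m) * (\<Prod>i\<in>UNIV. (G $ i) ^ Poly_Mapping.lookup m i))"
  unfolding mpoly_subst_def
  by (rule sum.mono_neutral_left) (use assms in \<open>auto simp: in_keys_iff\<close>)

lemma mpoly_subst_0 [simp]: "mpoly_subst 0 G = 0"
  by (simp add: mpoly_subst_def)

lemma mpoly_subst_single:
  "mpoly_subst (Poly_Mapping.single m c) G = mpoly_const c * (\<Prod>i\<in>UNIV. (G $ i) ^ Poly_Mapping.lookup m i)"
  by (cases "c = 0") (simp_all add: mpoly_subst_def)

lemma mpoly_subst_add: "mpoly_subst (p + q) G = mpoly_subst p G + mpoly_subst q G"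
  by (simp add: mpoly_subst_superset [of "Poly_Mapping.keys p \<union> Poly_Mapping.keys q"] keys_add
      lookup_add mpoly_const_add distrib_right sum.distrib)

lemma mpoly_subst_sum: "mpoly_subst (\<Sum>x\<in>A. f x) G = (\<Sum>x\<in>A. mpoly_subst (f x) G)"
  by (induction A rule: infinite_finite_induct) (auto simp: mpoly_subst_add)

lemma mpoly_subst_mult: "mpoly_subst (p * q) G = mpoly_subst p G * mpoly_subst q G"
proof -
  have "mpoly_subst (p * q) G =
    mpoly_subst ((\<Sum>m\<in>Poly_Mapping.keys p. Poly_Mapping.single m (Poly_Mapping.lookup p m)) *
      (\<Sum>l\<in>Poly_Mapping.keys q. Poly_Mapping.single l (Poly_Mapping.lookup q l))) G"
    by (simp add: sum_single_lookup)
  also have "\<dots> = mpoly_subst p G * mpoly_subst q G"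
    unfolding mpoly_subst_def [of p] mpoly_subst_def [of q] sum_product mpoly_subst_sum
    by (simp add: mult_single mpoly_subst_single lookup_add power_add prod.distrib mpoly_const_mult ac_simps)
  finally show ?thesis .
qed

lemma mpoly_subst_const [simp]: "mpoly_subst (mpoly_const c) G = mpoly_const c"
  unfolding mpoly_const_def [of c] mpoly_subst_single by (simp add: mpoly_const_def)

lemma mpoly_subst_1 [simp]: "mpoly_subst 1 G = 1"
  using mpoly_subst_const [of 1] by simp

lemma mpoly_subst_var [simp]: "mpoly_subst (mpoly_var i) G = G $ i"
proof -
  have "(\<Prod>j\<in>UNIV. (G $ j) ^ (1 when i = j)) = (\<Prod>j\<in>UNIV. if i = j then G $ j else 1)"
    by (intro prod.cong) (auto simp: when_def)
  then show ?thesis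
    by (simp add: mpoly_var_def mpoly_subst_single lookup_single)
qed

lemma mpoly_subst_power: "mpoly_subst (p ^ k) G = mpoly_subst p G ^ k"
  by (induction k) (auto simp: mpoly_subst_mult)

lemma mpoly_subst_prod: "mpoly_subst (\<Prod>x\<in>A. f x) G = (\<Prod>x\<in>A. mpoly_subst (f x) G)"
  by (induction A rule: infinite_finite_induct) (auto simp: mpoly_subst_mult)

lemma mpoly_subst_subst: "mpoly_subst (mpoly_subst p G) G' = mpoly_subst p (map_compose G G')"
  by (induction p rule: mpoly_induct) (auto simp: mpoly_subst_add mpoly_subst_mult map_compose_def)

section \<open>Formal partial derivatives\<close>

lemma mpoly_pderiv_superset:
  assumes "finite S" "Poly_Mapping.keys p \<subseteq> S"
  shows "mpoly_pderiv i p = (\<Sum>m\<in>S. Poly_Mapping.single (m - Poly_Mapping.single i 1)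
        (of_nat (Poly_Mapping.lookup m i) * Poly_Mapping.lookup p m))"
  unfolding mpoly_pderiv_def
  by (rule sum.mono_neutral_left) (use assms in \<open>auto simp: in_keys_iff\<close>)

lemma mpoly_pderiv_0 [simp]: "mpoly_pderiv i 0 = 0"
  by (simp add: mpoly_pderiv_def)

lemma mpoly_pderiv_single:
  "mpoly_pderiv i (Poly_Mapping.single m c) =
    Poly_Mapping.single (m - Poly_Mapping.single i 1) (of_nat (Poly_Mapping.lookup m i) * c)"
  by (cases "c = 0") (simp_all add: mpoly_pderiv_def)

lemma mpoly_pderiv_add: "mpoly_pderiv i (p + q) = mpoly_pderiv i p + mpoly_pderiv i q"
  by (simp add: mpoly_pderiv_superset [of "Poly_Mapping.keys p \<union> Poly_Mapping.keys q"] keys_add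
      lookup_add distrib_left single_add sum.distrib)

lemma mpoly_pderiv_sum: "mpoly_pderiv i (\<Sum>x\<in>A. f x) = (\<Sum>x\<in>A. mpoly_pderiv i (f x))"
  by (induction A rule: infinite_finite_induct) (auto simp: mpoly_pderiv_add)

lemma mpoly_pderiv_const [simp]: "mpoly_pderiv i (mpoly_const c) = 0"
  by (simp add: mpoly_const_def mpoly_pderiv_single)

lemma mpoly_pderiv_var: "mpoly_pderiv i (mpoly_var j) = (if i = j then 1 else 0)"
  by (auto simp: mpoly_var_def mpoly_pderiv_single lookup_single)

lemma single_diff_add_commute:
  fixes m l :: "'n \<Rightarrow>\<^sub>0 nat"
  assumes "Poly_Mapping.lookup m i > 0"
  shows "m - Poly_Mapping.single i 1 + l = m + l - Poly_Mapping.single i 1"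
  by (rule poly_mapping_eqI) (use assms in \<open>auto simp: lookup_add lookup_minus lookup_single when_def\<close>)

lemma mpoly_pderiv_mult_single:
  "mpoly_pderiv i (Poly_Mapping.single m a * Poly_Mapping.single l b) =
    mpoly_pderiv i (Poly_Mapping.single m a) * Poly_Mapping.single l b +
    Poly_Mapping.single m a * mpoly_pderiv i (Poly_Mapping.single l b)"
proof -
  let ?e = "Poly_Mapping.single i (1::nat)"
  \<comment> \<open>Truncated subtraction commutes with adding \<open>l\<close> only if variable
    \<open>i\<close> occurs in \<open>m\<close>; otherwise the coefficient is 0 and both sides
    vanish.\<close>
  have 1: "Poly_Mapping.single (m - ?e + l) (of_nat (Poly_Mapping.lookup m i) * a * b) =
    Poly_Mapping.single (m + l - ?e) (of_nat (Poly_Mapping.lookup m i) * a * b)"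
    using single_diff_add_commute [of m i l] by (cases "Poly_Mapping.lookup m i = 0") auto
  have 2: "Poly_Mapping.single (m + (l - ?e)) (a * (of_nat (Poly_Mapping.lookup l i) * b)) =
    Poly_Mapping.single (m + l - ?e) (a * (of_nat (Poly_Mapping.lookup l i) * b))"
    using single_diff_add_commute [of l i m]
    by (cases "Poly_Mapping.lookup l i = 0") (auto simp: add.commute)
  show ?thesis
    by (simp only: mult_single mpoly_pderiv_single 1 2 single_add [symmetric])
      (simp add: lookup_add algebra_simps)
qed

lemma mpoly_pderiv_mult: "mpoly_pderiv i (p * q) = mpoly_pderiv i p * q + p * mpoly_pderiv i q"
proof -
  let ?t = "\<lambda>p m. Poly_Mapping.single m (Poly_Mapping.lookup p m)"
  let ?P = "Poly_Mapping.keys p" and ?Q = "Poly_Mapping.keys q"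
  have "mpoly_pderiv i ((\<Sum>m\<in>?P. ?t p m) * (\<Sum>l\<in>?Q. ?t q l)) =
    mpoly_pderiv i (\<Sum>m\<in>?P. ?t p m) * (\<Sum>l\<in>?Q. ?t q l) +
    (\<Sum>m\<in>?P. ?t p m) * mpoly_pderiv i (\<Sum>l\<in>?Q. ?t q l)"
    by (simp add: sum_product mpoly_pderiv_sum mpoly_pderiv_mult_single sum.distrib)
  then show ?thesis by (simp add: sum_single_lookup)
qed

text \<open>Chain rule: both sides are additive in \<open>p\<close> and obey the same Leibniz rule
  along the substitution, so agreement on generators suffices.\<close>

lemma mpoly_pderiv_subst:
  "mpoly_pderiv j (mpoly_subst p G) = (\<Sum>k\<in>UNIV. mpoly_subst (mpoly_pderiv k p) G * mpoly_pderiv j (G $ k))"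
proof (induction p rule: mpoly_induct)
  case (var i)
  have "(\<Sum>k\<in>UNIV. mpoly_subst (mpoly_pderiv k (mpoly_var i)) G * mpoly_pderiv j (G $ k)) =
    (\<Sum>k\<in>UNIV. if k = i then mpoly_pderiv j (G $ k) else 0)"
    by (intro sum.cong) (auto simp: mpoly_pderiv_var)
  then show ?case by simp
qed (simp_all add: mpoly_pderiv_add mpoly_pderiv_mult mpoly_subst_add mpoly_subst_mult
    sum.distrib distrib_left distrib_right sum_distrib_left sum_distrib_right ac_simps)

text \<open>This is where characteristic 0 enters: a positive exponent stays nonzero as a
  coefficient. Lowering the exponent of \<open>i\<close> is injective on monomials containing
  variable \<open>i\<close>, so no terms of the derivative cancel.\<close>

lemma lookup_eq_0_if_mpoly_pderiv_eq_0:
  fixes p :: "('k::{comm_ring_1, ring_char_0, semiring_no_zero_divisors}, 'n) mpoly"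
  assumes "mpoly_pderiv i p = 0" "m \<in> Poly_Mapping.keys p"
  shows "Poly_Mapping.lookup m i = 0"
proof (rule ccontr)
  assume m: "Poly_Mapping.lookup m i \<noteq> 0"
  let ?e = "Poly_Mapping.single i (1::nat)"
  have "(of_nat (Poly_Mapping.lookup l i) * Poly_Mapping.lookup p l when l - ?e = m - ?e) =
    (of_nat (Poly_Mapping.lookup m i) * Poly_Mapping.lookup p m when l = m)" for l
  proof (cases "Poly_Mapping.lookup l i = 0 \<or> l = m")
    case False
    have "l - ?e \<noteq> m - ?e"
    proof
      assume "l - ?e = m - ?e"
      moreover have "l - ?e + ?e = l" "m - ?e + ?e = m"
        using single_diff_add_commute [of l i ?e] single_diff_add_commute [of m i ?e] False m by simp_all
      ultimately show False using False by metis
    qed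
    then show ?thesis using False by simp
  qed (use m in \<open>auto simp: when_def\<close>)
  then have "Poly_Mapping.lookup (mpoly_pderiv i p) (m - ?e) =
    (\<Sum>l\<in>Poly_Mapping.keys p. of_nat (Poly_Mapping.lookup m i) * Poly_Mapping.lookup p m when l = m)"
    by (simp add: mpoly_pderiv_def lookup_sum lookup_single)
  also have "\<dots> = of_nat (Poly_Mapping.lookup m i) * Poly_Mapping.lookup p m"
    using assms(2) by (simp add: when_def)
  finally show False using assms m by (simp add: in_keys_iff)
qed

section \<open>Weights and leading monomials\<close>

definition weight :: "('n::finite \<Rightarrow> nat) \<Rightarrow> ('n \<Rightarrow>\<^sub>0 nat) \<Rightarrow> nat"
  where "weight w m = (\<Sum>i\<in>UNIV. w i * Poly_Mapping.lookup m i)"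

text \<open>A predicate instead of a maximum: the zero polynomial needs no convention, and bounds
  propagate through the ring operations by closure rules.\<close>

definition weight_bounded :: "('n::finite \<Rightarrow> nat) \<Rightarrow> nat \<Rightarrow> ('k::zero, 'n) mpoly \<Rightarrow> bool"
  where "weight_bounded w N p \<longleftrightarrow> (\<forall>m\<in>Poly_Mapping.keys p. weight w m \<le> N)"

lemma weight_0 [simp]: "weight w 0 = 0"
  by (simp add: weight_def)

lemma weight_add: "weight w (m + l) = weight w m + weight w l"
  by (simp add: weight_def lookup_add distrib_left sum.distrib)

lemma weight_single [simp]: "weight w (Poly_Mapping.single i k) = w i * k"
proof -
  have "weight w (Poly_Mapping.single i k) = (\<Sum>j\<in>UNIV. if i = j then w j * k else 0)"
    unfolding weight_def by (intro sum.cong) (auto simp: lookup_single when_def)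
  then show ?thesis by simp
qed

lemma weight_boundedD: "weight_bounded w N p \<Longrightarrow> m \<in> Poly_Mapping.keys p \<Longrightarrow> weight w m \<le> N"
  by (simp add: weight_bounded_def)

lemma weight_bounded_mono: "weight_bounded w N p \<Longrightarrow> N \<le> N' \<Longrightarrow> weight_bounded w N' p"
  by (fastforce simp: weight_bounded_def)

lemma weight_bounded_0 [simp]: "weight_bounded w N 0"
  by (simp add: weight_bounded_def)

lemma weight_bounded_const [simp]: "weight_bounded w N (mpoly_const c)"
  by (simp add: weight_bounded_def mpoly_const_def)

lemma weight_bounded_1 [simp]: "weight_bounded w N (1 :: ('k::comm_semiring_1, 'n::finite) mpoly)"
  by (simp add: weight_bounded_def)

lemma weight_bounded_var: "w i \<le> N \<Longrightarrow> weight_bounded w N (mpoly_var i)"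
  by (simp add: weight_bounded_def mpoly_var_def)

lemma weight_bounded_add: "weight_bounded w N p \<Longrightarrow> weight_bounded w N q \<Longrightarrow> weight_bounded w N (p + q)"
  using keys_add [of p q] by (auto simp: weight_bounded_def)

lemma weight_bounded_diff:
  "weight_bounded w N p \<Longrightarrow> weight_bounded w N q \<Longrightarrow> weight_bounded w N (p - q)"
  for p q :: "('k::ab_group_add, 'n::finite) mpoly"
  by (auto simp: weight_bounded_def in_keys_iff lookup_minus)

lemma weight_bounded_mult:
  "weight_bounded w N p \<Longrightarrow> weight_bounded w N' q \<Longrightarrow> weight_bounded w (N + N') (p * q)"
  unfolding weight_bounded_def
proof
  fix m
  assume *: "\<forall>m\<in>Poly_Mapping.keys p. weight w m \<le> N" "\<forall>m\<in>Poly_Mapping.keys q. weight w m \<le> N'"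
  assume "m \<in> Poly_Mapping.keys (p * q)"
  then obtain a b where "m = a + b" "a \<in> Poly_Mapping.keys p" "b \<in> Poly_Mapping.keys q"
    using keys_mult [of p q] by blast
  then show "weight w m \<le> N + N'"
    using * by (simp add: weight_add add_mono)
qed

lemma weight_bounded_sum:
  "(\<And>x. x \<in> A \<Longrightarrow> weight_bounded w N (f x)) \<Longrightarrow> weight_bounded w N (\<Sum>x\<in>A. f x)"
  by (induction A rule: infinite_finite_induct) (auto intro: weight_bounded_add)

lemma weight_bounded_power:
  "weight_bounded w N p \<Longrightarrow> weight_bounded w (N * k) (p ^ k)"
  for p :: "('k::comm_semiring_1, 'n::finite) mpoly"
  by (induction k) (auto intro: weight_bounded_mult)

lemma weight_bounded_prod:
  fixes f :: "'a \<Rightarrow> ('k::comm_semiring_1, 'n::finite) mpoly"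
  shows "(\<And>x. x \<in> A \<Longrightarrow> weight_bounded w (N x) (f x)) \<Longrightarrow> weight_bounded w (\<Sum>x\<in>A. N x) (\<Prod>x\<in>A. f x)"
  by (induction A rule: infinite_finite_induct) (auto intro: weight_bounded_mult)

text \<open>The weight \<open>w i\<close> of a variable bounds the polynomial put in its place, so a
  monomial \<open>m\<close> turns into a polynomial of weight at most
  \<open>weight w m\<close>.\<close>

lemma weight_bounded_subst:
  fixes p :: "('k::comm_semiring_1, 'n::finite) mpoly"
  assumes p: "weight_bounded w N p" and G: "\<And>i. weight_bounded w' (w i) (G $ i)"
  shows "weight_bounded w' N (mpoly_subst p G)"
  unfolding mpoly_subst_def
proof (rule weight_bounded_sum)
  fix m assume m: "m \<in> Poly_Mapping.keys p"
  have "weight_bounded w' (0 + weight w m)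
    (mpoly_const (Poly_Mapping.lookup p m) * (\<Prod>i\<in>UNIV. (G $ i) ^ Poly_Mapping.lookup m i))"
    unfolding weight_def
    by (intro weight_bounded_mult weight_bounded_prod weight_bounded_power weight_bounded_const G)
  then show "weight_bounded w' N
    (mpoly_const (Poly_Mapping.lookup p m) * (\<Prod>i\<in>UNIV. (G $ i) ^ Poly_Mapping.lookup m i))"
    using weight_boundedD [OF p m] by (auto elim: weight_bounded_mono)
qed

abbreviation exponent_degree :: "('n::finite \<Rightarrow>\<^sub>0 nat) \<Rightarrow> nat"
  where "exponent_degree \<equiv> weight (\<lambda>_. Suc 0)"

lemma total_degree_le_iff: "total_degree p \<le> N \<longleftrightarrow> weight_bounded (\<lambda>_. Suc 0) N p"
  by (auto simp: total_degree_def weight_bounded_def weight_def)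

lemma exponent_degree_le_total_degree:
  "m \<in> Poly_Mapping.keys p \<Longrightarrow> exponent_degree m \<le> total_degree p"
  using total_degree_le_iff weight_boundedD by blast

lemma total_degree_attained:
  assumes "total_degree p > 0"
  shows "\<exists>m\<in>Poly_Mapping.keys p. exponent_degree m = total_degree p"
proof -
  have "total_degree p \<in> insert 0 (exponent_degree ` Poly_Mapping.keys p)"
    unfolding total_degree_def weight_def by (simp only: mult_1 One_nat_def [symmetric]) (rule Max_in, auto)
  \<comment> \<open>Positivity excludes the default value \<open>0\<close> inserted under the
    maximum.\<close>
  then show ?thesis using assms by auto
qed

section \<open>Leading monomials with respect to a weight\<close>

lemma finite_obtains_max_image:
  fixes f :: "'a \<Rightarrow> 'b::linorder"
  assumes "finite A" "A \<noteq> {}"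
  obtains y where "y \<in> A" "\<And>z. z \<in> A \<Longrightarrow> f z \<le> f y"
proof -
  have "Max (f ` A) \<in> f ` A" using assms by (intro Max_in) auto
  then obtain y where "y \<in> A" "Max (f ` A) = f y" by blast
  moreover from this have "f z \<le> f y" if "z \<in> A" for z using that assms by (metis Max_ge finite_imageI imageI)
  ultimately show ?thesis using that by blast
qed

text \<open>Replaces the leading term of a monomial order: the weight only has to single out
  \<open>m\<close> among the monomials of this one polynomial and may tie elsewhere.\<close>

definition leading :: "('n::finite \<Rightarrow> nat) \<Rightarrow> ('n \<Rightarrow>\<^sub>0 nat) \<Rightarrow> ('k::comm_semiring_1, 'n) mpoly \<Rightarrow> bool"
  where "leading w m p \<longleftrightarrow>
    (\<exists>c p'. c \<noteq> 0 \<and> p = Poly_Mapping.single m c + p' \<and> (\<forall>l\<in>Poly_Mapping.keys p'. weight w l < weight w m))"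

lemma leading_single: "c \<noteq> 0 \<Longrightarrow> leading w m (Poly_Mapping.single m c)"
  unfolding leading_def by (rule exI [of _ c], rule exI [of _ 0]) simp

text \<open>Weights add, so every other product of terms is strictly lighter than the product of the
  leading terms, which survives because there are no zero divisors.\<close>

lemma leading_mult:
  fixes p q :: "('k::{comm_semiring_1, semiring_no_zero_divisors}, 'n::finite) mpoly"
  assumes "leading w m p" "leading w l q"
  shows "leading w (m + l) (p * q)"
proof -
  obtain c p' where p: "c \<noteq> 0" "p = Poly_Mapping.single m c + p'"
      "\<And>x. x \<in> Poly_Mapping.keys p' \<Longrightarrow> weight w x < weight w m"
    using assms(1) unfolding leading_def by blast
  obtain d q' where q: "d \<noteq> 0" "q = Poly_Mapping.single l d + q'"
      "\<And>x. x \<in> Poly_Mapping.keys q' \<Longrightarrow> weight w x < weight w l"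
    using assms(2) unfolding leading_def by blast
  define s where "s = Poly_Mapping.single m c * q' + p' * Poly_Mapping.single l d + p' * q'"
  have "Poly_Mapping.keys s \<subseteq> Poly_Mapping.keys (Poly_Mapping.single m c * q') \<union>
      Poly_Mapping.keys (p' * Poly_Mapping.single l d) \<union> Poly_Mapping.keys (p' * q')"
    unfolding s_def by (intro order.trans [OF keys_add] Un_mono keys_add order_refl)
  moreover have "Poly_Mapping.keys (Poly_Mapping.single m c * q') \<subseteq> (\<lambda>x. m + x) ` Poly_Mapping.keys q'"
    using keys_mult [of "Poly_Mapping.single m c" q'] p(1) by auto
  moreover have "Poly_Mapping.keys (p' * Poly_Mapping.single l d) \<subseteq> (\<lambda>x. x + l) ` Poly_Mapping.keys p'"
    using keys_mult [of p' "Poly_Mapping.single l d"] q(1) by auto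
  ultimately have keys_s: "Poly_Mapping.keys s \<subseteq> (\<lambda>x. m + x) ` Poly_Mapping.keys q' \<union>
      (\<lambda>x. x + l) ` Poly_Mapping.keys p' \<union> Poly_Mapping.keys (p' * q')"
    by (meson order.trans Un_mono order_refl)
  have "weight w x < weight w (m + l)" if "x \<in> Poly_Mapping.keys (p' * q')" for x
  proof -
    obtain a b where "x = a + b" "a \<in> Poly_Mapping.keys p'" "b \<in> Poly_Mapping.keys q'"
      using \<open>x \<in> _\<close> keys_mult [of p' q'] by blast
    then show ?thesis using p(3) [of a] q(3) [of b] by (simp add: weight_add)
  qed
  then have "weight w x < weight w (m + l)" if "x \<in> Poly_Mapping.keys s" for x
    using subsetD [OF keys_s that] p(3) q(3) by (auto simp: weight_add)
  moreover have "p * q = Poly_Mapping.single (m + l) (c * d) + s"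
    by (simp add: p(2) q(2) s_def distrib_left distrib_right mult_single ac_simps)
  ultimately show ?thesis
    unfolding leading_def using p(1) q(1) by (intro exI [of _ "c * d"] exI [of _ s]) auto
qed

text \<open>The constant sum stands for the \<open>k\<close>-fold multiple of
  \<open>m\<close>.\<close>

lemma leading_power:
  fixes p :: "('k::{comm_semiring_1, semiring_no_zero_divisors}, 'n::finite) mpoly"
  assumes "leading w m p"
  shows "leading w (\<Sum>_<k. m) (p ^ k)"
proof (induction k)
  case 0
  then show ?case using leading_single [of 1 w 0] by simp
next
  case (Suc k)
  then show ?case using leading_mult [OF assms Suc] by (simp add: add.commute)
qed

text \<open>Among the terms with nonzero coefficient, take one whose leading exponent is heaviest.
  That exponent occurs in no other such term: the other leading exponents differ from it by
  injectivity, even if they have the same weight, and all remaining exponents are lighter.\<close>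

lemma leading_independent:
  fixes f :: "'a \<Rightarrow> ('k::{comm_semiring_1, semiring_no_zero_divisors}, 'n::finite) mpoly"
  assumes "finite A" "inj_on \<mu> A" and lead: "\<And>x. x \<in> A \<Longrightarrow> leading w (\<mu> x) (f x)"
    and zero: "(\<Sum>x\<in>A. mpoly_const (c x) * f x) = 0"
    and "x \<in> A"
  shows "c x = 0"
proof (rule ccontr)
  assume "c x \<noteq> 0"
  define B where "B = {x\<in>A. c x \<noteq> 0}"
  have "finite B" "B \<noteq> {}" using \<open>finite A\<close> \<open>c x \<noteq> 0\<close> \<open>x \<in> A\<close> by (auto simp: B_def)
  then obtain y where y: "y \<in> B" "\<And>z. z \<in> B \<Longrightarrow> weight w (\<mu> z) \<le> weight w (\<mu> y)"
    using finite_obtains_max_image [of B "\<lambda>z. weight w (\<mu> z)"] by blast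
  have "Poly_Mapping.lookup (f z) (\<mu> y) = 0" if "z \<in> A" "z \<noteq> y" "c z \<noteq> 0" for z
  proof -
    obtain b p where p: "f z = Poly_Mapping.single (\<mu> z) b + p"
        "\<And>l. l \<in> Poly_Mapping.keys p \<Longrightarrow> weight w l < weight w (\<mu> z)"
      using lead [OF \<open>z \<in> A\<close>] unfolding leading_def by blast
    have "\<mu> z \<noteq> \<mu> y" using that y(1) \<open>inj_on \<mu> A\<close> by (auto simp: B_def inj_on_def)
    moreover have "\<mu> y \<notin> Poly_Mapping.keys p" using p(2) [of "\<mu> y"] y(2) [of z] that by (auto simp: B_def)
    ultimately show ?thesis by (simp add: p(1) lookup_add lookup_single in_keys_iff)
  qed
  then have "(\<Sum>z\<in>A. c z * Poly_Mapping.lookup (f z) (\<mu> y)) =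
    (\<Sum>z\<in>{y}. c z * Poly_Mapping.lookup (f z) (\<mu> y))"
    using \<open>finite A\<close> y(1) by (intro sum.mono_neutral_right) (auto simp: B_def)
  moreover have "Poly_Mapping.lookup (f y) (\<mu> y) \<noteq> 0"
  proof -
    obtain b p where p: "b \<noteq> 0" "f y = Poly_Mapping.single (\<mu> y) b + p"
        "\<And>l. l \<in> Poly_Mapping.keys p \<Longrightarrow> weight w l < weight w (\<mu> y)"
      using lead [of y] y(1) unfolding leading_def B_def by blast
    then show ?thesis using p(1,2) p(3) [of "\<mu> y"] by (cases "\<mu> y \<in> Poly_Mapping.keys p") (auto simp: lookup_add in_keys_iff)
  qed
  moreover have "(\<Sum>z\<in>A. c z * Poly_Mapping.lookup (f z) (\<mu> y)) = 0"
    using arg_cong [OF zero, of "\<lambda>p. Poly_Mapping.lookup p (\<mu> y)"] by (simp add: lookup_sum lookup_mpoly_const_mult)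
  ultimately show False using y(1) by (simp add: B_def)
qed

text \<open>
  A point of maximal Euclidean norm among the top-degree exponents is the unique maximum of the
  functional given by its own inner product, by Cauchy--Schwarz; a large multiple of the degree
  is added to dominate the exponents of lower degree.
\<close>

lemma exists_leading:
  fixes q :: "('k::comm_ring_1, 'n::finite) mpoly"
  assumes "total_degree q > 0"
  obtains w \<mu> where "leading w \<mu> q" "exponent_degree \<mu> = total_degree q"
proof -
  define e where "e = total_degree q"
  define S where "S = {m\<in>Poly_Mapping.keys q. exponent_degree m = e}"
  define sq where "sq = (\<lambda>m :: 'n \<Rightarrow>\<^sub>0 nat. \<Sum>i\<in>UNIV. (Poly_Mapping.lookup m i)\<^sup>2)"
  have "finite S" "S \<noteq> {}"
    using total_degree_attained [OF assms] by (auto simp: S_def e_def)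
  then obtain \<mu> where \<mu>: "\<mu> \<in> S" "\<And>m. m \<in> S \<Longrightarrow> sq m \<le> sq \<mu>"
    using finite_obtains_max_image [of S sq] by blast
  \<comment> \<open>The entries of \<open>\<mu>\<close> are at most \<open>e\<close>, so its inner
    product with an exponent of degree below \<open>e\<close> is at most \<open>e\<^sup>2\<close>;
    one more unit of degree outweighs this.\<close>
  define w where "w = (\<lambda>i. e\<^sup>2 + 1 + Poly_Mapping.lookup \<mu> i)"
  have w: "weight w m = (e\<^sup>2 + 1) * exponent_degree m + (\<Sum>i\<in>UNIV. Poly_Mapping.lookup \<mu> i * Poly_Mapping.lookup m i)" for m
    by (simp only: weight_def w_def distrib_right sum.distrib sum_distrib_left mult_1 One_nat_def [symmetric])
  have deg_\<mu>: "exponent_degree \<mu> = e" using \<mu>(1) by (simp add: S_def)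
  have less: "weight w m < weight w \<mu>" if m: "m \<in> Poly_Mapping.keys q" "m \<noteq> \<mu>" for m
  proof (cases "exponent_degree m = e")
    case True
    obtain i where "Poly_Mapping.lookup m i \<noteq> Poly_Mapping.lookup \<mu> i"
      using m(2) by (metis poly_mapping_eqI)
    \<comment> \<open>Strict Cauchy--Schwarz by expanding the squared distance of \<open>m\<close>
      and \<open>\<mu>\<close>, over the integers because the differences may be negative.\<close>
    then have "0 < (int (Poly_Mapping.lookup m i) - int (Poly_Mapping.lookup \<mu> i))\<^sup>2" by simp
    also have "\<dots> \<le> (\<Sum>i\<in>UNIV. (int (Poly_Mapping.lookup m i) - int (Poly_Mapping.lookup \<mu> i))\<^sup>2)"
      by (intro member_le_sum) auto
    also have "\<dots> = int (sq m) + int (sq \<mu>) - 2 * int (\<Sum>i\<in>UNIV. Poly_Mapping.lookup \<mu> i * Poly_Mapping.lookup m i)"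
      by (simp add: sq_def power2_diff sum.distrib sum_subtractf sum_distrib_left algebra_simps)
    finally have "(\<Sum>i\<in>UNIV. Poly_Mapping.lookup \<mu> i * Poly_Mapping.lookup m i) < sq \<mu>"
      using \<mu>(2) [of m] m(1) True unfolding S_def by (simp del: of_nat_sum)
    then show ?thesis using True deg_\<mu> by (simp add: w sq_def power2_eq_square)
  next
    case False
    then have lt: "exponent_degree m < e"
      using exponent_degree_le_total_degree [OF m(1)] by (simp add: e_def)
    have "Poly_Mapping.lookup \<mu> i \<le> e" for i
      using member_le_sum [of i UNIV "Poly_Mapping.lookup \<mu>"] deg_\<mu> by (simp add: weight_def)
    then have "(\<Sum>i\<in>UNIV. Poly_Mapping.lookup \<mu> i * Poly_Mapping.lookup m i) \<le> e * exponent_degree m"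
      by (auto simp: weight_def sum_distrib_left intro: sum_mono)
    also have "\<dots> \<le> e\<^sup>2" using lt by (simp add: power2_eq_square)
    finally have "weight w m < (e\<^sup>2 + 1) * (exponent_degree m + 1)" by (simp add: w)
    also have "\<dots> \<le> (e\<^sup>2 + 1) * e" using lt by (intro mult_le_mono2) simp
    also have "\<dots> \<le> weight w \<mu>" using deg_\<mu> by (simp add: w)
    finally show ?thesis .
  qed
  let ?c = "Poly_Mapping.lookup q \<mu>"
  have "?c \<noteq> 0" using \<mu>(1) by (simp add: S_def in_keys_iff)
  moreover have "weight w l < weight w \<mu>" if "l \<in> Poly_Mapping.keys (q - Poly_Mapping.single \<mu> ?c)" for l
    using that by (intro less) (auto simp: in_keys_iff lookup_minus lookup_single when_def split: if_splits)
  ultimately have "leading w \<mu> q"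
    unfolding leading_def by (intro exI [of _ ?c] exI [of _ "q - Poly_Mapping.single \<mu> ?c"]) simp
  then show ?thesis using that deg_\<mu> by (simp add: e_def)
qed

text \<open>Gaussian elimination, one coordinate of \<open>M\<close> at a time. The vectors form an
  indexed family, so equal vectors at different indices count separately.\<close>

lemma exists_linear_relation:
  fixes a :: "'a \<Rightarrow> 'b \<Rightarrow> 'k::field"
  assumes "finite M" "finite A" "card M < card A"
  shows "\<exists>c. (\<exists>x\<in>A. c x \<noteq> 0) \<and> (\<forall>m\<in>M. (\<Sum>x\<in>A. c x * a x m) = 0)"
  using assms
proof (induction M arbitrary: A a rule: finite_induct)
  case empty
  then have "A \<noteq> {}" by auto
  then show ?case by (intro exI [of _ "\<lambda>_. 1"]) auto
next
  case (insert m M)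
  show ?case
  proof (cases "\<exists>y\<in>A. a y m \<noteq> 0")
    case False
    obtain c where c: "\<exists>x\<in>A. c x \<noteq> 0" "\<forall>m\<in>M. (\<Sum>x\<in>A. c x * a x m) = 0"
      using insert.IH [of A a] insert.prems insert.hyps by auto
    then show ?thesis using False by (intro exI [of _ c]) auto
  next
    case True
    then obtain y where y: "y \<in> A" "a y m \<noteq> 0" by blast
    let ?A = "A - {y}"
    have "card M < card ?A" using insert.prems insert.hyps y by simp
    then obtain c where c: "\<exists>x\<in>?A. c x \<noteq> 0"
        "\<forall>l\<in>M. (\<Sum>x\<in>?A. c x * (a x l - a x m / a y m * a y l)) = 0"
      using insert.IH [of ?A "\<lambda>x l. a x l - a x m / a y m * a y l"] insert.prems by auto
    \<comment> \<open>The coefficient of the pivot row \<open>y\<close> undoes the elimination;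
      coordinate \<open>m\<close> then vanishes because it was cleared from all other rows.\<close>
    define c' where "c' = c(y := - (\<Sum>x\<in>?A. c x * (a x m / a y m)))"
    have sum: "(\<Sum>x\<in>A. c' x * a x l) = (\<Sum>x\<in>?A. c x * (a x l - a x m / a y m * a y l))" for l
    proof -
      have "(\<Sum>x\<in>A. c' x * a x l) = c' y * a y l + (\<Sum>x\<in>?A. c' x * a x l)"
        using y insert.prems by (intro sum.remove) auto
      also have "(\<Sum>x\<in>?A. c' x * a x l) = (\<Sum>x\<in>?A. c x * a x l)"
        by (intro sum.cong) (auto simp: c'_def)
      also have "c' y * a y l + \<dots> = (\<Sum>x\<in>?A. c x * (a x l - a x m / a y m * a y l))"
        by (simp add: c'_def sum_distrib_right right_diff_distrib sum_subtractf mult.assoc)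
      finally show ?thesis .
    qed
    have "\<exists>x\<in>A. c' x \<noteq> 0" using c(1) by (auto simp: c'_def)
    then show ?thesis using c(2) y by (intro exI [of _ c'] conjI) (auto simp: sum)
  qed
qed

section \<open>Counting exponents\<close>

text \<open>Every entry is at most \<open>D\<close>. The crude bound suffices, as only polynomial
  growth in \<open>D\<close> matters.\<close>

lemma finite_exponents [simp]: "finite {m :: 'n::finite \<Rightarrow>\<^sub>0 nat. exponent_degree m \<le> D}" (is ?fin)
  and card_exponents_le:
    "card {m :: 'n \<Rightarrow>\<^sub>0 nat. exponent_degree m \<le> D} \<le> (D + 1) ^ CARD('n)" (is ?le)
proof -
  let ?E = "{m :: 'n \<Rightarrow>\<^sub>0 nat. exponent_degree m \<le> D}" and ?P = "UNIV \<rightarrow>\<^sub>E {..D} :: ('n \<Rightarrow> nat) set"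
  have inj: "inj_on Poly_Mapping.lookup ?E" by (auto intro: inj_onI poly_mapping_eqI)
  have sub: "Poly_Mapping.lookup ` ?E \<subseteq> ?P"
  proof safe
    fix m :: "'n \<Rightarrow>\<^sub>0 nat" and i
    assume "exponent_degree m \<le> D"
    then show "Poly_Mapping.lookup m i \<le> D"
      using member_le_sum [of i UNIV "Poly_Mapping.lookup m"] by (simp add: weight_def)
  qed simp
  have fin: "finite ?P" by (simp add: finite_PiE)
  show ?fin by (rule inj_on_finite [OF inj sub fin])
  show ?le using card_inj_on_le [OF inj sub fin] by (simp add: card_funcsetE)
qed

text \<open>Divide the entries in \<open>J\<close> by \<open>d\<close> with remainder. The
  remainders take \<open>d ^ card J\<close> values, and the quotients together with the other
  entries form an exponent of degree at most \<open>D\<close>.\<close>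

lemma finite_exponents_weight_le [simp]:
    "d > 0 \<Longrightarrow> finite {m :: 'n::finite \<Rightarrow>\<^sub>0 nat. weight (\<lambda>i. if i \<in> J then 1 else d) m \<le> d * D}" (is "_ \<Longrightarrow> ?fin")
  and card_exponents_weight_le:
    "d > 0 \<Longrightarrow> card {m :: 'n \<Rightarrow>\<^sub>0 nat. weight (\<lambda>i. if i \<in> J then 1 else d) m \<le> d * D} \<le>
      card {m :: 'n \<Rightarrow>\<^sub>0 nat. exponent_degree m \<le> D} * d ^ card J" (is "_ \<Longrightarrow> ?le")
proof -
  assume d: "d > 0"
  let ?w = "\<lambda>i. if i \<in> J then 1 else d"
  let ?M = "{m :: 'n \<Rightarrow>\<^sub>0 nat. weight ?w m \<le> d * D}" and ?E = "{m :: 'n \<Rightarrow>\<^sub>0 nat. exponent_degree m \<le> D}"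
  define quo where "quo = (\<lambda>m :: 'n \<Rightarrow>\<^sub>0 nat. Abs_poly_mapping
    (\<lambda>i. if i \<in> J then Poly_Mapping.lookup m i div d else Poly_Mapping.lookup m i))"
  define rem where "rem = (\<lambda>m :: 'n \<Rightarrow>\<^sub>0 nat. \<lambda>i\<in>J. Poly_Mapping.lookup m i mod d)"
  have lookup_quo: "Poly_Mapping.lookup (quo m) i =
    (if i \<in> J then Poly_Mapping.lookup m i div d else Poly_Mapping.lookup m i)" for m i
    by (simp add: quo_def)
  have inj: "inj_on (\<lambda>m. (quo m, rem m)) ?M"
  proof (rule inj_onI, rule poly_mapping_eqI)
    fix m l i
    assume "(quo m, rem m) = (quo l, rem l)"
    then have "Poly_Mapping.lookup (quo m) i = Poly_Mapping.lookup (quo l) i" "rem m i = rem l i"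
      by simp_all
    then have "Poly_Mapping.lookup m i = Poly_Mapping.lookup l i \<or>
        Poly_Mapping.lookup m i div d = Poly_Mapping.lookup l i div d \<and>
        Poly_Mapping.lookup m i mod d = Poly_Mapping.lookup l i mod d"
      by (cases "i \<in> J") (simp_all add: lookup_quo rem_def)
    then show "Poly_Mapping.lookup m i = Poly_Mapping.lookup l i"
      by (metis div_mult_mod_eq)
  qed
  have sub: "(\<lambda>m. (quo m, rem m)) ` ?M \<subseteq> ?E \<times> (J \<rightarrow>\<^sub>E {..<d})"
  proof (rule image_subsetI)
    fix m :: "'n \<Rightarrow>\<^sub>0 nat" assume "m \<in> ?M"
    moreover have "d * exponent_degree (quo m) \<le> weight ?w m"
      unfolding weight_def sum_distrib_left by (intro sum_mono) (auto simp: lookup_quo)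
    ultimately have "d * exponent_degree (quo m) \<le> d * D" using order.trans by blast
    then have "exponent_degree (quo m) \<le> D" using d by simp
    moreover have "rem m \<in> J \<rightarrow>\<^sub>E {..<d}" using d by (auto simp: rem_def)
    ultimately show "(quo m, rem m) \<in> ?E \<times> (J \<rightarrow>\<^sub>E {..<d})" by simp
  qed
  have fin: "finite (?E \<times> (J \<rightarrow>\<^sub>E {..<d}))" by (simp add: finite_PiE)
  show ?fin by (rule inj_on_finite [OF inj sub fin])
  show ?le
    using card_inj_on_le [OF inj sub fin] by (simp add: card_cartesian_product card_funcsetE)
qed

text \<open>The last condition says that the monomial of \<open>a\<close> is not divisible by that
  of \<open>\<mu>\<close>. This makes \<open>b\<close> the largest multiple of \<open>\<mu>\<close>
  contained in \<open>a\<close> plus \<open>b\<close> times \<open>\<mu>\<close>, so the pair can be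
  recovered from that exponent.\<close>

definition exponent_pairs :: "('n::finite \<Rightarrow>\<^sub>0 nat) \<Rightarrow> nat \<Rightarrow> (('n \<Rightarrow>\<^sub>0 nat) \<times> nat) set"
  where "exponent_pairs \<mu> D = {(a, b). exponent_degree a + b \<le> D \<and>
    \<not> (\<forall>i. Poly_Mapping.lookup \<mu> i \<le> Poly_Mapping.lookup a i)}"

lemma finite_degree_pairs [simp]: "finite {(a :: 'n::finite \<Rightarrow>\<^sub>0 nat, b). exponent_degree a + b \<le> D}"
  by (rule finite_subset [of _ "{a. exponent_degree a \<le> D} \<times> {..D}"]) auto

lemma finite_exponent_pairs [simp]: "finite (exponent_pairs \<mu> D)"
  by (rule finite_subset [OF _ finite_degree_pairs [of D]]) (auto simp: exponent_pairs_def)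

text \<open>Count all pairs of total degree at most \<open>D\<close> plus the degree of
  \<open>\<mu>\<close> in two ways. Raising \<open>b\<close> by that degree embeds the pairs of
  bound \<open>D\<close> and leaves out those with small \<open>b\<close>. Adding
  \<open>\<mu>\<close> to \<open>a\<close> instead covers every pair whose \<open>a\<close> is
  divisible by \<open>\<mu>\<close>. The number of pairs of bound \<open>D\<close> cancels.\<close>

lemma card_exponent_pairs_ge:
  fixes \<mu> :: "'n::finite \<Rightarrow>\<^sub>0 nat"
  shows "exponent_degree \<mu> * card {a :: 'n \<Rightarrow>\<^sub>0 nat. exponent_degree a \<le> D} \<le>
    card (exponent_pairs \<mu> (D + exponent_degree \<mu>))"
proof -
  let ?e = "exponent_degree \<mu>"
  let ?E = "{a :: 'n \<Rightarrow>\<^sub>0 nat. exponent_degree a \<le> D}"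
  let ?T = "\<lambda>D. {(a :: 'n \<Rightarrow>\<^sub>0 nat, b). exponent_degree a + b \<le> D}"
  let ?shift = "\<lambda>(a :: 'n \<Rightarrow>\<^sub>0 nat, b). (a, b + ?e)" and ?shift' = "\<lambda>(a, b :: nat). (a + \<mu>, b)"
  have inj: "inj_on ?shift (?T D)" by (auto simp: inj_on_def)
  have "card (?E \<times> {..<?e}) + card (?shift ` ?T D) = card (?E \<times> {..<?e} \<union> ?shift ` ?T D)"
    by (rule card_Un_disjoint [symmetric]) (auto intro!: finite_imageI finite_degree_pairs)
  also have "\<dots> \<le> card (?T (D + ?e))"
    by (intro card_mono finite_degree_pairs) auto
  also have "\<dots> \<le> card (exponent_pairs \<mu> (D + ?e) \<union> ?shift' ` ?T D)"
  proof (rule card_mono, safe)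
    fix a :: "'n \<Rightarrow>\<^sub>0 nat" and b
    assume ab: "exponent_degree a + b \<le> D + ?e" "(a, b) \<notin> ?shift' ` ?T D"
    show "(a, b) \<in> exponent_pairs \<mu> (D + ?e)"
    proof (rule ccontr)
      assume "(a, b) \<notin> exponent_pairs \<mu> (D + ?e)"
      then have le: "Poly_Mapping.lookup \<mu> i \<le> Poly_Mapping.lookup a i" for i
        using ab(1) by (simp add: exponent_pairs_def)
      have a: "a = (a - \<mu>) + \<mu>"
        by (rule poly_mapping_eqI) (use le in \<open>simp add: lookup_add lookup_minus\<close>)
      then have "exponent_degree a = exponent_degree (a - \<mu>) + ?e"
        by (metis weight_add)
      then have "(a - \<mu>, b) \<in> ?T D" using ab(1) by simp
      then have "?shift' (a - \<mu>, b) \<in> ?shift' ` ?T D" by (rule imageI)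
      then show False using ab(2) a by simp
    qed
  qed (rule finite_exponent_pairs, rule finite_imageI [OF finite_degree_pairs])
  also have "\<dots> \<le> card (exponent_pairs \<mu> (D + ?e)) + card (?T D)"
    by (intro order.trans [OF card_Un_le] add_left_mono card_image_le finite_degree_pairs)
  finally have "card ?E * ?e + card (?T D) \<le> card (exponent_pairs \<mu> (D + ?e)) + card (?T D)"
    by (simp only: card_image [OF inj] card_cartesian_product card_lessThan)
  then show ?thesis by (simp add: mult.commute)
qed

text \<open>If \<open>e\<close> were at least \<open>Q + 1\<close>, iterating \<open>step\<close>
  would make \<open>C (k * e)\<close> grow at least like the \<open>k\<close>-th power of
  \<open>(Q + 1) / Q\<close>, against the polynomial bound.\<close>

lemma polynomial_growth_bound:
  fixes C :: "nat \<Rightarrow> nat"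
  assumes pos: "Q > 0" "C 0 > 0"
    and step: "\<And>D. e * C D \<le> Q * C (D + e)"
    and growth: "\<And>D. C D \<le> (D + 1) ^ n"
  shows "e \<le> Q"
proof (rule ccontr)
  assume "\<not> e \<le> Q"
  have exp: "(Q + 1) ^ k \<le> Q ^ k * C (k * e)" for k
  proof (induction k)
    case (Suc k)
    have "(Q + 1) ^ Suc k \<le> (Q + 1) * (Q ^ k * C (k * e))"
      using mult_le_mono2 [OF Suc, of "Q + 1"] by simp
    also have "\<dots> \<le> e * (Q ^ k * C (k * e))" using \<open>\<not> e \<le> Q\<close> by (intro mult_le_mono1) simp
    also have "\<dots> = Q ^ k * (e * C (k * e))" by simp
    also have "\<dots> \<le> Q ^ k * (Q * C (k * e + e))" by (intro mult_le_mono2 step)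
    finally show ?case by (simp add: ac_simps)
  qed (use pos in simp)
  \<comment> \<open>A weak form of Bernoulli's inequality,
    \<open>j / Q \<le> (1 + 1 / Q) ^ j\<close>, cleared of denominators.\<close>
  have bernoulli: "j * Q ^ j \<le> Q * (Q + 1) ^ j" for j
  proof (induction j)
    case (Suc j)
    have "Suc j * Q ^ Suc j = Q * (j * Q ^ j) + Q * Q ^ j" by (simp add: algebra_simps)
    also have "\<dots> \<le> Q * (Q * (Q + 1) ^ j) + Q * (Q + 1) ^ j"
      using Suc by (intro add_mono mult_le_mono2 power_mono) auto
    finally show ?case by (simp add: algebra_simps)
  qed simp
  \<comment> \<open>The \<open>N\<close>-th power of Bernoulli's inequality, with \<open>N\<close>
    above the growth exponent \<open>n\<close>, leaves one spare factor \<open>j\<close>;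
    \<open>j\<close> is one more than what that factor may be.\<close>
  define N j where "N = n + 1" and "j = Q ^ N * (N * e + 1) ^ n + 1"
  have "j ^ N * Q ^ (j * N) = (j * Q ^ j) ^ N" by (simp add: power_mult power_mult_distrib)
  also have "\<dots> \<le> (Q * (Q + 1) ^ j) ^ N" by (intro power_mono bernoulli) simp
  also have "\<dots> = Q ^ N * (Q + 1) ^ (j * N)" by (simp add: power_mult power_mult_distrib)
  also have "\<dots> \<le> Q ^ N * (Q ^ (j * N) * (j * N * e + 1) ^ n)"
    by (intro mult_le_mono2 order.trans [OF exp] growth)
  also have "\<dots> \<le> Q ^ N * (Q ^ (j * N) * (j * (N * e + 1)) ^ n)"
    by (intro mult_le_mono2 power_mono) (auto simp: j_def algebra_simps)
  also have "\<dots> = (j ^ n * Q ^ (j * N)) * (Q ^ N * (N * e + 1) ^ n)"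
    by (simp only: power_mult_distrib ac_simps)
  also have "j ^ N * Q ^ (j * N) = (j ^ n * Q ^ (j * N)) * j"
    by (simp add: N_def)
  finally have "(j ^ n * Q ^ (j * N)) * j \<le> (j ^ n * Q ^ (j * N)) * (Q ^ N * (N * e + 1) ^ n)" .
  moreover have "j ^ n * Q ^ (j * N) > 0" using pos by (simp add: j_def)
  ultimately have "j \<le> Q ^ N * (N * e + 1) ^ n" by (metis mult_le_cancel1)
  then show False by (simp add: j_def)
qed

section \<open>The degree bound\<close>

text \<open>If two pairs gave the same exponent with different multiples of \<open>\<mu>\<close>,
  the first component of the pair with the smaller multiple would contain
  \<open>\<mu>\<close>.\<close>

lemma exponent_pairs_inj:
  "inj_on (\<lambda>(a, b). a + (\<Sum>_<b. \<mu>)) (exponent_pairs \<mu> D)"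
proof -
  have le: "b \<le> b'" if "(a', b') \<in> exponent_pairs \<mu> D" "a + (\<Sum>_<b. \<mu>) = a' + (\<Sum>_<b'. \<mu>)" for a b a' b'
  proof (rule ccontr)
    assume "\<not> b \<le> b'"
    have "Poly_Mapping.lookup \<mu> i \<le> Poly_Mapping.lookup a' i" for i
    proof -
      have "Poly_Mapping.lookup a i + b * Poly_Mapping.lookup \<mu> i = Poly_Mapping.lookup a' i + b' * Poly_Mapping.lookup \<mu> i"
        using arg_cong [OF that(2), of "\<lambda>m. Poly_Mapping.lookup m i"] by (simp add: lookup_add lookup_sum)
      moreover have "(b' + 1) * Poly_Mapping.lookup \<mu> i \<le> b * Poly_Mapping.lookup \<mu> i"
        using \<open>\<not> b \<le> b'\<close> by (intro mult_le_mono1) simp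
      ultimately show ?thesis by simp
    qed
    then show False using that(1) by (simp add: exponent_pairs_def)
  qed
  show ?thesis
  proof (rule inj_onI, clarify)
    fix a b a' b'
    assume *: "(a, b) \<in> exponent_pairs \<mu> D" "(a', b') \<in> exponent_pairs \<mu> D"
      "a + (\<Sum>_<b. \<mu>) = a' + (\<Sum>_<b'. \<mu>)"
    then have "b = b'" using le [of a' b' a b] le [of a b a' b'] by (simp add: le_antisym)
    then show "a = a' \<and> b = b'" using * by simp
  qed
qed

text \<open>
  \<open>Z - mpoly_subst h S\<close> generates the ideal of algebraic relations between the components of \<open>P\<close>
  and \<open>h\<close>, so this is an instance of Perron's bound on the degree of such relations.
\<close>

lemma total_degree_le_of_weight_bounded:
  fixes P S :: "('k::field, 'n::finite) poly_map" and h :: "('k, 'n) mpoly"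
  assumes d: "d > 0"
    and P: "\<And>j. weight_bounded (\<lambda>i. if i \<in> J then 1 else d) d (P $ j)"
    and h: "weight_bounded (\<lambda>i. if i \<in> J then 1 else d) d h"
    and S: "map_compose P S = id_map"
  shows "total_degree (mpoly_subst h S) \<le> d ^ card J"
proof (cases "total_degree (mpoly_subst h S) = 0")
  case False
  define w where "w = (\<lambda>i. if i \<in> J then 1 else d)"
  define q where "q = mpoly_subst h S"
  obtain v \<mu> where lead: "leading v \<mu> q" and \<mu>: "exponent_degree \<mu> = total_degree q"
    using exists_leading [of q] False q_def by blast
  define C where "C = (\<lambda>D. card {a :: 'n \<Rightarrow>\<^sub>0 nat. exponent_degree a \<le> D})"
  have PS: "mpoly_subst (P $ j) S = mpoly_var j" for j
    using arg_cong [OF S, of "\<lambda>G. G $ j"] by (simp add: map_compose_def id_map_def)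
  \<comment> \<open>More pairs than monomials of weight at most \<open>d * D\<close> would force a
    linear relation between the products, which the substitution of \<open>S\<close> carries to
    polynomials with distinct leading exponents.\<close>
  have upper: "card (exponent_pairs \<mu> D) \<le> C D * d ^ card J" for D
  proof (rule ccontr)
    let ?A = "exponent_pairs \<mu> D" and ?M = "{m. weight w m \<le> d * D}"
    define f where "f = (\<lambda>(a, b). (\<Prod>j\<in>UNIV. (P $ j) ^ Poly_Mapping.lookup a j) * h ^ b)"
    assume "\<not> card ?A \<le> C D * d ^ card J"
    then have "card ?M < card ?A"
      using card_exponents_weight_le [OF d, of J D] by (simp add: w_def C_def)
    moreover have "finite ?M" using finite_exponents_weight_le [OF d] by (simp add: w_def)
    ultimately obtain c x where c: "x \<in> ?A" "c x \<noteq> 0"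
        "\<And>m. m \<in> ?M \<Longrightarrow> (\<Sum>x\<in>?A. c x * Poly_Mapping.lookup (f x) m) = 0"
      using exists_linear_relation [of ?M ?A "\<lambda>x. Poly_Mapping.lookup (f x)"] by auto
    have bounded: "weight_bounded w (d * D) (f x)" if "x \<in> ?A" for x
    proof (cases x)
      case (Pair a b)
      have "weight_bounded w ((\<Sum>j\<in>UNIV. d * Poly_Mapping.lookup a j) + d * b) (f x)"
        unfolding Pair f_def prod.case
        by (intro weight_bounded_mult weight_bounded_prod weight_bounded_power P [folded w_def] h [folded w_def])
      moreover have "(\<Sum>j\<in>UNIV. d * Poly_Mapping.lookup a j) + d * b = d * (exponent_degree a + b)"
        by (simp add: weight_def sum_distrib_left distrib_left)
      moreover have "d * (exponent_degree a + b) \<le> d * D"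
        using that Pair by (intro mult_le_mono2) (simp add: exponent_pairs_def)
      ultimately show ?thesis by (metis weight_bounded_mono)
    qed
    \<comment> \<open>The choice of \<open>c\<close> handles the coefficients at \<open>?M\<close>;
      elsewhere each product has coefficient 0 by its weight bound.\<close>
    have "(\<Sum>x\<in>?A. mpoly_const (c x) * f x) = 0"
    proof (rule poly_mapping_eqI)
      fix m
      have "Poly_Mapping.lookup (f x) m = 0" if "x \<in> ?A" "m \<notin> ?M" for x
        using weight_boundedD [OF bounded [OF that(1)], of m] that(2) by (auto simp: in_keys_iff)
      then show "Poly_Mapping.lookup (\<Sum>x\<in>?A. mpoly_const (c x) * f x) m = Poly_Mapping.lookup 0 m"
        using c(3) [of m] by (cases "m \<in> ?M") (simp_all add: lookup_sum lookup_mpoly_const_mult)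
    qed
    then have "mpoly_subst (\<Sum>x\<in>?A. mpoly_const (c x) * f x) S = 0" by simp
    then have "(\<Sum>x\<in>?A. mpoly_const (c x) * mpoly_subst (f x) S) = 0"
      by (simp add: mpoly_subst_sum mpoly_subst_mult)
    moreover have "leading v ((\<lambda>(a, b). a + (\<Sum>_<b. \<mu>)) x) (mpoly_subst (f x) S)" for x
    proof (cases x)
      case (Pair a b)
      have "mpoly_subst (f x) S = Poly_Mapping.single a 1 * q ^ b"
        by (simp add: Pair f_def mpoly_subst_mult mpoly_subst_prod mpoly_subst_power PS q_def
            single_one_eq_prod_var)
      then show ?thesis
        using leading_mult [OF leading_single [of 1 v a] leading_power [OF lead, of b]] Pair by simp
    qed
    ultimately show False
      using leading_independent [OF finite_exponent_pairs exponent_pairs_inj,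
          of \<mu> D v "\<lambda>x. mpoly_subst (f x) S" c x] c(1,2) by simp
  qed
  have "total_degree q \<le> d ^ card J"
  proof (rule polynomial_growth_bound [where C = C])
    show "C 0 > 0"
      using finite_exponents [of 0] weight_0 unfolding C_def by (subst card_gt_0_iff) blast
    show "C D \<le> (D + 1) ^ CARD('n)" for D unfolding C_def by (rule card_exponents_le)
    show "total_degree q * C D \<le> d ^ card J * C (D + total_degree q)" for D
      using card_exponent_pairs_ge [of \<mu> D] upper [of "D + total_degree q"]
      by (simp add: C_def \<mu> mult.commute)
  qed (use d in simp)
  then show ?thesis by (simp add: q_def)
qed simp

section \<open>Linear changes of coordinates\<close>

lemma map_compose_nth: "map_compose F G $ i = mpoly_subst (F $ i) G"
  by (simp add: map_compose_def)

lemma map_compose_assoc: "map_compose (map_compose F G) G' = map_compose F (map_compose G G')"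
  by (simp add: vec_eq_iff map_compose_nth mpoly_subst_subst)

lemma map_compose_id_left [simp]: "map_compose id_map G = G"
  by (simp add: vec_eq_iff map_compose_nth id_map_def)

definition linear_map :: "'k::comm_semiring_1 ^ 'n ^ 'n \<Rightarrow> ('k, 'n::finite) poly_map"
  where "linear_map A = (\<chi> i. \<Sum>j\<in>UNIV. mpoly_const (A $ i $ j) * mpoly_var j)"

lemma map_compose_linear: "map_compose (linear_map A) (linear_map B) = linear_map (A ** B)"
proof (rule vec_eq_iff [THEN iffD2], rule allI)
  fix i
  have "map_compose (linear_map A) (linear_map B) $ i =
    (\<Sum>j\<in>UNIV. \<Sum>k\<in>UNIV. mpoly_const (A $ i $ j) * (mpoly_const (B $ j $ k) * mpoly_var k))"
    by (simp add: map_compose_nth linear_map_def mpoly_subst_sum mpoly_subst_mult sum_distrib_left)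
  also have "\<dots> = (\<Sum>k\<in>UNIV. \<Sum>j\<in>UNIV. mpoly_const (A $ i $ j) * (mpoly_const (B $ j $ k) * mpoly_var k))"
    by (rule sum.swap)
  also have "\<dots> = linear_map (A ** B) $ i"
    by (simp add: linear_map_def matrix_matrix_mult_def mpoly_const_sum mpoly_const_mult sum_distrib_right mult.assoc)
  finally show "map_compose (linear_map A) (linear_map B) $ i = linear_map (A ** B) $ i" .
qed

lemma linear_map_id: "linear_map (mat 1) = id_map"
proof (rule vec_eq_iff [THEN iffD2], rule allI)
  fix i
  have "linear_map (mat 1) $ i = (\<Sum>j\<in>UNIV. if i = j then mpoly_var j else 0)"
    unfolding linear_map_def mat_def vec_lambda_beta by (rule sum.cong) auto
  then show "linear_map (mat 1) $ i = id_map $ i" by (simp add: id_map_def)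
qed

lemma weight_bounded_linear_map:
  assumes "\<And>i. w i \<le> N"
  shows "weight_bounded w N (linear_map A $ i)"
proof -
  have "weight_bounded w (0 + N) (mpoly_const (A $ i $ j) * mpoly_var j)" for j
    by (intro weight_bounded_mult weight_bounded_const weight_bounded_var assms)
  then show ?thesis by (simp add: linear_map_def weight_bounded_sum)
qed

lemma mpoly_pderiv_linear_map: "mpoly_pderiv k (linear_map A $ l) = mpoly_const (A $ l $ k)"
proof -
  have "mpoly_pderiv k (linear_map A $ l) = (\<Sum>j\<in>UNIV. if k = j then mpoly_const (A $ l $ j) else 0)"
    unfolding linear_map_def vec_lambda_beta mpoly_pderiv_sum
    by (rule sum.cong) (auto simp: mpoly_pderiv_mult mpoly_pderiv_var)
  then show ?thesis by simp
qed

text \<open>By the chain rule this derivative is row \<open>j\<close> of the Jacobian matrix times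
  column \<open>k\<close> of \<open>A\<close>, evaluated at the linear map.\<close>

lemma mpoly_pderiv_subst_linear_map_eq_0:
  assumes "column k A \<in> const_kernel H"
  shows "mpoly_pderiv k (mpoly_subst (H $ j) (linear_map A)) = 0"
proof -
  have "(jacobian_mat H *v const_vec (column k A)) $ j = 0"
    using assms by (simp add: const_kernel_def)
  then have "mpoly_subst (\<Sum>l\<in>UNIV. mpoly_pderiv l (H $ j) * mpoly_const (A $ l $ k)) (linear_map A) = 0"
    by (simp add: matrix_vector_mult_def jacobian_mat_def const_vec_def column_def)
  then show ?thesis
    by (simp add: mpoly_pderiv_subst mpoly_pderiv_linear_map mpoly_subst_sum mpoly_subst_mult)
qed

text \<open>The columns of \<open>A\<close> are a basis of \<open>K\<close> extended to the whole
  space; \<open>J\<close> indexes the added vectors.\<close>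

lemma exists_adapted_basis_matrix:
  fixes K :: "('k::field ^ 'n::finite) set"
  obtains A B :: "'k ^ 'n ^ 'n" and J :: "'n set"
  where "A ** B = mat 1" "card J = CARD('n) - vec.dim K" "\<And>j. j \<notin> J \<Longrightarrow> column j A \<in> K"
proof -
  obtain B where B: "B \<subseteq> K" "vec.independent B" "card B = vec.dim K"
    by (rule vec.basis_exists)
  define B' where "B' = vec.extend_basis B"
  have B': "B \<subseteq> B'" "vec.independent B'" "vec.span B' = UNIV"
    using vec.extend_basis_superset [OF B(2)] vec.independent_extend_basis [OF B(2)]
      vec.span_extend_basis [OF B(2)] by (simp_all add: B'_def)
  have "card B' = CARD('n)"
    using vec.basis_card_eq_dim [of B' UNIV] B' vec_dim_card by auto
  moreover have "finite B'" using B'(2) by (rule vec.finiteI_independent)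
  ultimately obtain \<phi> :: "'n \<Rightarrow> 'k ^ 'n" where \<phi>: "bij_betw \<phi> UNIV B'"
    using finite_same_card_bij [of "UNIV :: 'n set" B'] by auto
  define A :: "'k ^ 'n ^ 'n" where "A = (\<chi> i j. \<phi> j $ i)"
  have column: "column j A = \<phi> j" for j by (simp add: A_def column_def vec_eq_iff)
  have "columns A = B'"
    using bij_betw_imp_surj_on [OF \<phi>] by (auto simp: columns_def column)
  then obtain A' where "A ** A' = mat 1"
    using matrix_right_invertible_span_columns [of A] B'(3) by auto
  moreover have "card {j. \<phi> j \<notin> B} = CARD('n) - vec.dim K"
  proof -
    have "bij_betw \<phi> {j. \<phi> j \<notin> B} (B' - B)"
      using bij_betw_imp_surj_on [OF \<phi>] bij_betw_imp_inj_on [OF \<phi>]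
      by (auto simp: bij_betw_def inj_on_def)
    then have "card {j. \<phi> j \<notin> B} = card (B' - B)" by (rule bij_betw_same_card)
    also have "\<dots> = card B' - card B"
      using B'(1) \<open>finite B'\<close> by (intro card_Diff_subset) (auto intro: finite_subset)
    finally show ?thesis using \<open>card B' = _\<close> B(3) by simp
  qed
  ultimately show ?thesis using that [of A A' "{j. \<phi> j \<notin> B}"] B(1) column by auto
qed

section \<open>Degrees of polynomial maps and the final estimate\<close>

lemma total_degree_nth_le_map_degree: "total_degree (F $ i) \<le> map_degree F"
  by (simp add: map_degree_def)

lemma map_degree_le_iff: "map_degree F \<le> N \<longleftrightarrow> (\<forall>i. total_degree (F $ i) \<le> N)"
  by (auto simp: map_degree_def)

text \<open>A constant map stays constant under composition, while the identity is not
  constant.\<close>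

lemma map_degree_pos_of_right_inverse:
  fixes F G :: "('k::comm_semiring_1, 'n::finite) poly_map"
  assumes "map_compose F G = id_map"
  shows "map_degree F > 0"
proof (rule ccontr)
  fix i :: 'n
  assume "\<not> map_degree F > 0"
  then have "weight_bounded (\<lambda>_. Suc 0) 0 (F $ i)"
    using total_degree_nth_le_map_degree [of F i] by (simp add: total_degree_le_iff [symmetric])
  \<comment> \<open>Degree 0 means weight 0 for any weights; these match the degrees of the
    polynomials substituted next.\<close>
  then have "weight_bounded (\<lambda>_. map_degree G) 0 (F $ i)"
    by (simp add: weight_bounded_def weight_def)
  moreover have "weight_bounded (\<lambda>_. Suc 0) (map_degree G) (G $ j)" for j
    using total_degree_nth_le_map_degree [of G j] by (simp add: total_degree_le_iff [symmetric])
  ultimately have "weight_bounded (\<lambda>_. Suc 0) 0 (mpoly_subst (F $ i) G)"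
    by (rule weight_bounded_subst)
  moreover have "mpoly_subst (F $ i) G = mpoly_var i"
    using assms by (simp add: map_compose_nth [symmetric] id_map_def)
  ultimately show False by (simp add: weight_bounded_def mpoly_var_def)
qed

theorem theorem3p4:
  fixes F H G :: "('k::field_char_0, 'n::finite) poly_map"
    and d r :: nat
  assumes "F = id_map + H"
    and "is_inverse_map F G"
    and "map_degree F = d"
    and "r \<le> CARD('n)"
    and "vec.dim (const_kernel H) = CARD('n) - r"
  shows "map_degree G \<le> d ^ r"
  unfolding map_degree_le_iff
proof
  fix i
  have FG: "map_compose F G = id_map" using assms(2) by (simp add: is_inverse_map_def)
  have d: "d > 0" using map_degree_pos_of_right_inverse [OF FG] assms(3) by simp
  obtain A B :: "'k ^ 'n ^ 'n" and J where AB: "A ** B = mat 1"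
      and card_J: "card J = CARD('n) - vec.dim (const_kernel H)"
      and kernel: "\<And>j. j \<notin> J \<Longrightarrow> column j A \<in> const_kernel H"
    using exists_adapted_basis_matrix [of "const_kernel H"] by blast
  \<comment> \<open>With truncated subtraction, \<open>r \<le> CARD('n)\<close> is what makes the
    complement of the complement equal to \<open>r\<close>.\<close>
  have J: "card J = r" using card_J assms(4,5) by simp
  let ?w = "\<lambda>i. if i \<in> J then 1 else d"
  let ?L = "linear_map A"
  \<comment> \<open>\<open>P\<close> is \<open>F\<close> with its source in the new coordinates and
    \<open>S\<close> is its right inverse; the components of \<open>G\<close> are linear forms in
    \<open>S\<close>.\<close>
  define P where "P = map_compose F ?L"
  define S where "S = map_compose (linear_map B) G"
  have LS: "map_compose ?L S = G"
    by (simp add: S_def map_compose_assoc [symmetric] map_compose_linear AB linear_map_id)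
  have PS: "map_compose P S = id_map"
    by (simp add: P_def map_compose_assoc LS FG)
  have P: "weight_bounded ?w d (P $ j)" for j
  proof -
    define q where "q = mpoly_subst (H $ j) ?L"
    have Pj: "P $ j = ?L $ j + q"
      by (simp add: P_def q_def map_compose_nth assms(1) mpoly_subst_add id_map_def)
    have "weight_bounded (\<lambda>_. Suc 0) d (F $ j)"
      using total_degree_nth_le_map_degree [of F j] assms(3) by (simp add: total_degree_le_iff [symmetric])
    then have "weight_bounded (\<lambda>_. Suc 0) d (P $ j)"
      unfolding P_def map_compose_nth by (rule weight_bounded_subst) (rule weight_bounded_linear_map, simp)
    moreover have "weight_bounded (\<lambda>_. Suc 0) d (?L $ j)"
      using d by (intro weight_bounded_linear_map) simp
    \<comment> \<open>The bound on \<open>q\<close> comes from the difference of \<open>P\<close>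
      and its linear summand, both of degree at most \<open>d\<close> because \<open>d\<close> is
      positive.\<close>
    ultimately have "weight_bounded (\<lambda>_. Suc 0) d (P $ j - ?L $ j)" by (rule weight_bounded_diff)
    then have q: "weight_bounded (\<lambda>_. Suc 0) d q" by (simp add: Pj)
    \<comment> \<open>The derivatives of \<open>q\<close> outside \<open>J\<close> vanish, so only
      variables of weight 1 occur in it.\<close>
    have "weight ?w m = exponent_degree m" if "m \<in> Poly_Mapping.keys q" for m
    proof -
      have "Poly_Mapping.lookup m k = 0" if "k \<notin> J" for k
        using mpoly_pderiv_subst_linear_map_eq_0 [OF kernel [OF that], of j] \<open>m \<in> _\<close>
        by (intro lookup_eq_0_if_mpoly_pderiv_eq_0 [of k q]) (simp_all add: q_def)
      then show ?thesis unfolding weight_def by (intro sum.cong) auto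
    qed
    then have "weight_bounded ?w d q" using q by (simp add: weight_bounded_def)
    then show ?thesis
      unfolding Pj using d by (intro weight_bounded_add weight_bounded_linear_map) auto
  qed
  have "total_degree (mpoly_subst (?L $ i) S) \<le> d ^ card J"
    using d by (intro total_degree_le_of_weight_bounded [OF d P _ PS] weight_bounded_linear_map) simp
  then show "total_degree (G $ i) \<le> d ^ r"
    using LS by (simp add: J map_compose_nth [symmetric])
qed

end
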